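(* Let bounds $a_l$ on the fastest signal speed to the left and $a_r$ on the highest signal speed to the right be given for the Riemann problem with left state $u_l$ and right state $u_r$, $a_l<a_r$, and let $M\ge\max(|a_l|,|a_r|)$. Let $u$ be a self-similar weak solution of this Riemann problem. Put $$u_{lr}=\frac{a_r u_r-a_l u_l+f(u_l)-f(u_r)}{a_r-a_l}.$$ Then the maximum entropy dissipation of the Riemann problem solution on the interval $\theta=(-M,M)$ is bounded from below by $$E^\theta_u(t)-E^\theta_u(0)\ \ge\ t\left((a_r-a_l)U(u_{lr})+a_lU(u_l)-a_rU(u_r)\right).$$ The rate is bounded from below by $$\frac{\mathrm{d}E^\theta_u}{\mathrm{d}t}\Big|_{t=0}\ \ge\ (a_r-a_l)U(u_{lr})+a_lU(u_l)-a_rU(u_r).$$ The entropy dissipation is bounded by $$s^\theta\ \ge\ t\left((a_r-a_l)U(u_{lr})+a_lU(u_l)-a_rU(u_r)+F(u_l)-F(u_r)\right),$$ and its rate by $$\sigma^\theta\ \ge\ (a_r-a_l)U(u_{lr})+a_lU(u_l)-a_rU(u_r)+F(u_l)-F(u_r).$$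
   Context: Consider a hyperbolic system of conservation laws $\partial_t u+\partial_x f(u)=0$ in one space dimension with $u(x,t)\in\mathbb{R}^m$ and flux $f:\mathbb{R}^m\to\mathbb{R}^m$. An entropy is a convex function $U:\mathbb{R}^m\to\mathbb{R}$ that satisfies, together with an entropy flux $F:\mathbb{R}^m\to\mathbb{R}$, the relation $\frac{\mathrm{d}f}{\mathrm{d}u}\frac{\mathrm{d}U}{\mathrm{d}u}=\frac{\mathrm{d}F}{\mathrm{d}u}$ (read as gradient of $U$ times Jacobian of $f$ equals gradient of $F$); $(U,F)$ is a fixed such pair. The Riemann problem has initial data $u(x,0)=u_l$ for $x<0$ and $u(x,0)=u_r$ for $x>0$, with $u_l,u_r\in\mathbb{R}^m$. That $a_l$ and $a_r$ bound the signal speeds means that the initial condition is unaltered to the left of the line $x=a_l t$ and to the right of the line $x=a_r t$, i.e. $u=u_l$ and $u=u_r$ there, respectively. Self-similar means invariant under $(x,t)\mapsto(\mu x,\mu t)$ for $\mu>0$. The total entropy on $\theta$ is $E^\theta_u(t)=\int_\theta U(u(x,t))\,\mathrm{d}x$. The entropy dissipation on $\theta$ between times $t_1$ and $t_2$ is $$s^\theta_u(t_1,t_2)=\int_{t_1}^{t_2}\int_\theta \frac{\partial U}{\partial t}+\frac{\partial F}{\partial x}\,\mathrm{d}x\,\mathrm{d}t,$$ and in the claim $s^\theta$ denotes $s^\theta_u(0,t)$. The entropy dissipation speed (rate) is $$\sigma^\theta_u(t)=\frac{\partial s^\theta_u(t_0,t)}{\partial t}=\int_\theta \frac{\partial U}{\partial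 t}+\frac{\partial F}{\partial x}\,\mathrm{d}x,$$ written $\sigma^\theta$ in the claim.
   Formalization: The flux terms in the last two bounds are F(u_r)−F(u_l) in place of F(u_l)−F(u_r), and times are limited to t≥0 with t·max(|a_l|,|a_r|)≤M (strictly less for the rate σ); as printed, the claims fail for f(u)=u, U=F=u². *)

theory Defs
  imports "HOL-Analysis.Analysis"
begin

text \<open>
  Points of space-time are pairs \<open>(x, t)\<close>.  States are elements of \<open>real ^ 'm\<close>, and a solution
  is a function \<open>u x t\<close> of which only the values with \<open>t \<ge> 0\<close> matter.
\<close>

definition hyperbolic :: "(real ^ 'm \<Rightarrow> real ^ 'm) \<Rightarrow> bool" where
  "hyperbolic f \<longleftrightarrow>
     (\<forall>w. f differentiable (at w) \<and>
          (\<exists>(P :: real ^ 'm ^ 'm) (D :: real ^ 'm ^ 'm). invertible P \<and> (\<forall>i j. i \<noteq> j \<longrightarrow> D $ i $ j = 0) \<and>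
                 jacobian f (at w) = P ** D ** matrix_inv P))"

definition entropy_pair ::
    "(real ^ 'm \<Rightarrow> real ^ 'm) \<Rightarrow> (real ^ 'm \<Rightarrow> real) \<Rightarrow> (real ^ 'm \<Rightarrow> real) \<Rightarrow> bool" where
  "entropy_pair f U F \<longleftrightarrow>
     convex_on UNIV U \<and>
     (\<forall>w. \<exists>g h. GDERIV U w :> g \<and> GDERIV F w :> h \<and> g v* jacobian f (at w) = h)"

definition partial_x :: "(real \<times> real \<Rightarrow> real) \<Rightarrow> real \<times> real \<Rightarrow> real" where
  "partial_x \<phi> = (\<lambda>(x, t). deriv (\<lambda>y. \<phi> (y, t)) x)"

definition partial_t :: "(real \<times> real \<Rightarrow> real) \<Rightarrow> real \<times> real \<Rightarrow> real" where
  "partial_t \<phi> = (\<lambda>(x, t). deriv (\<lambda>s. \<phi> (x, s)) t)"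

definition test_function :: "(real \<times> real \<Rightarrow> real) \<Rightarrow> bool" where
  "test_function \<phi> \<longleftrightarrow>
     \<phi> differentiable_on UNIV \<and>
     continuous_on UNIV (partial_x \<phi>) \<and> continuous_on UNIV (partial_t \<phi>) \<and>
     compact (closure {p. \<phi> p \<noteq> 0})"

definition locally_integrable :: "(real \<Rightarrow> real \<Rightarrow> 'b::euclidean_space) \<Rightarrow> bool" where
  "locally_integrable v \<longleftrightarrow>
     (\<forall>K. compact K \<and> K \<subseteq> UNIV \<times> {0..} \<longrightarrow> set_integrable lborel K (\<lambda>(x, t). v x t))"

text \<open>
  Test functions in \<open>weak_solution\<close> need not vanish at \<open>t = 0\<close>, so the last integral imposes
  the initial values \<open>u x 0\<close>.
\<close>

definition weak_solution ::
    "(real ^ 'm \<Rightarrow> real ^ 'm) \<Rightarrow> (real \<Rightarrow> real \<Rightarrow> real ^ 'm) \<Rightarrow> bool" where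
  "weak_solution f u \<longleftrightarrow>
     locally_integrable u \<and> locally_integrable (\<lambda>x t. f (u x t)) \<and>
     (\<forall>r. set_integrable lborel {-r..r} (\<lambda>x. u x 0)) \<and>
     (\<forall>\<phi>. test_function \<phi> \<longrightarrow>
        (LINT (x, t) : UNIV \<times> {0<..} | lborel.
            partial_t \<phi> (x, t) *\<^sub>R u x t + partial_x \<phi> (x, t) *\<^sub>R f (u x t))
        + (LINT x | lborel. \<phi> (x, 0) *\<^sub>R u x 0) = 0)"

definition riemann_solution ::
    "(real ^ 'm \<Rightarrow> real ^ 'm) \<Rightarrow> real ^ 'm \<Rightarrow> real ^ 'm \<Rightarrow> (real \<Rightarrow> real \<Rightarrow> real ^ 'm) \<Rightarrow> bool" where
  "riemann_solution f ul ur u \<longleftrightarrow>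
     weak_solution f u \<and> (\<forall>x<0. u x 0 = ul) \<and> (\<forall>x>0. u x 0 = ur)"

definition signal_speed_bounds ::
    "real \<Rightarrow> real \<Rightarrow> real ^ 'm \<Rightarrow> real ^ 'm \<Rightarrow> (real \<Rightarrow> real \<Rightarrow> real ^ 'm) \<Rightarrow> bool" where
  "signal_speed_bounds al ar ul ur u \<longleftrightarrow>
     (\<forall>t>0. \<forall>x. (x < al * t \<longrightarrow> u x t = ul) \<and> (x > ar * t \<longrightarrow> u x t = ur))"

definition self_similar :: "(real \<Rightarrow> real \<Rightarrow> real ^ 'm) \<Rightarrow> bool" where
  "self_similar u \<longleftrightarrow> (\<forall>\<mu>>0. \<forall>x. \<forall>t\<ge>0. u (\<mu> * x) (\<mu> * t) = u x t)"

definition total_entropy ::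
    "(real ^ 'm \<Rightarrow> real) \<Rightarrow> (real \<Rightarrow> real \<Rightarrow> real ^ 'm) \<Rightarrow> real set \<Rightarrow> real \<Rightarrow> real" where
  "total_entropy U u \<theta> t = (LINT x : \<theta> | lborel. U (u x t))"

text \<open>
  For a discontinuous \<open>u\<close> the expression \<open>\<partial>U/\<partial>t + \<partial>F/\<partial>x\<close> has no pointwise meaning (its classical
  value almost everywhere misses the contribution of the shocks).  It is the distribution
  \<open>\<phi> \<mapsto> - \<integral>\<integral> U \<phi>\<^sub>t + F \<phi>\<^sub>x\<close> on the open half plane \<open>t > 0\<close>, and to integrate it over a set it has
  to be a signed Radon measure.  The signed measure is given as a difference \<open>P - N\<close> of two
  locally finite positive measures; its values on the bounded Borel subsets of the open half
  plane depend only on the distribution.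
\<close>

definition entropy_production_measure ::
    "(real ^ 'm \<Rightarrow> real) \<Rightarrow> (real ^ 'm \<Rightarrow> real) \<Rightarrow> (real \<Rightarrow> real \<Rightarrow> real ^ 'm) \<Rightarrow>
     (real \<times> real) measure \<Rightarrow> (real \<times> real) measure \<Rightarrow> bool" where
  "entropy_production_measure U F u P N \<longleftrightarrow>
     sets P = sets borel \<and> sets N = sets borel \<and>
     (\<forall>K. compact K \<longrightarrow> emeasure P K < \<infinity> \<and> emeasure N K < \<infinity>) \<and>
     locally_integrable (\<lambda>x t. U (u x t)) \<and> locally_integrable (\<lambda>x t. F (u x t)) \<and>
     (\<forall>\<phi>. test_function \<phi> \<and> closure {p. \<phi> p \<noteq> 0} \<subseteq> UNIV \<times> {0<..} \<longrightarrow>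
        (LINT p | P. \<phi> p) - (LINT p | N. \<phi> p) =
        - (LINT (x, t) : UNIV \<times> {0<..} | lborel.
             U (u x t) * partial_t \<phi> (x, t) + F (u x t) * partial_x \<phi> (x, t)))"

definition entropy_dissipation ::
    "(real \<times> real) measure \<Rightarrow> (real \<times> real) measure \<Rightarrow> real set \<Rightarrow> real \<Rightarrow> real \<Rightarrow> real" where
  "entropy_dissipation P N \<theta> t1 t2 =
     measure P (\<theta> \<times> {t1<..<t2}) - measure N (\<theta> \<times> {t1<..<t2})"

text \<open>
  The rate is the derivative with respect to the final time, for every initial time \<open>t0\<close>;
  only \<open>t \<ge> t0\<close> makes sense, so the derivative is one-sided at \<open>t = t0\<close>.
\<close>

definition has_entropy_dissipation_rate ::
    "(real \<times> real) measure \<Rightarrow> (real \<times> real) measure \<Rightarrow> real set \<Rightarrow> real \<Rightarrow> real \<Rightarrow> bool" where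
  "has_entropy_dissipation_rate P N \<theta> t \<sigma> \<longleftrightarrow>
     (\<forall>t0. 0 \<le> t0 \<and> t0 \<le> t \<longrightarrow>
        ((\<lambda>\<tau>. entropy_dissipation P N \<theta> t0 \<tau>) has_real_derivative \<sigma>) (at t within {t0..}))"

end

theory Submission
  imports Defs
begin

text \<open>
  A self-similar solution is a dilation \<open>u x t = w (x / t)\<close> of its profile \<open>w\<close> at time \<open>1\<close>, and outside the
  cone \<open>al * t \<le> x \<le> ar * t\<close> it keeps its initial values.  Hence for a function \<open>V\<close> of the
  state, integrable along \<open>w\<close>, the surplus of the integral of \<open>V (u x t)\<close> over its
  initial value grows exactly linearly, as \<open>t * K\<^sub>V\<close>, where \<open>K\<^sub>V\<close> is the integral of \<open>V (w y)\<close> minus \<open>V\<close> of the initial step at \<open>y\<close> (the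
  \<open>excess\<close>).  This holds as long as the cone has not left the interval, i.e. for \<open>t * m \<le> M\<close> with
  \<open>m = max \<bar>al\<bar> \<bar>ar\<bar>\<close>.  So the difference quotients of the total entropy are all equal to \<open>K\<^sub>U\<close>, and
  it remains to bound \<open>K\<^sub>U\<close> from below.

  Splitting off the constant states turns \<open>K\<^sub>V\<close> into the integral of \<open>V (w y)\<close> over \<open>[al, ar]\<close> plus
  \<open>al * V ul - ar * V ur\<close>.  For the state itself the weak form of the conservation law gives
  the excess \<open>f ul - f ur\<close> (\<open>weak_riemann_excess\<close>), so the mean of \<open>w\<close> over
  \<open>[al, ar]\<close> is \<open>ulr\<close>.  Jensen's inequality for the convex \<open>U\<close> (\<open>jensen_interval\<close>) then yields
  \<open>K\<^sub>U \<ge> (ar - al) * U ulr + al * U ul - ar * U ur\<close>, the bound for the total entropy and for its rate.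

  The entropy production is the balance of the growth \<open>K\<^sub>U\<close> and the flux difference
  \<open>F ur - F ul\<close> through the ends of the interval: the production measure of
  \<open>(-M, M) \<times> (t0, t1)\<close> equals \<open>(t1 - t0) * (K\<^sub>U + F ur - F ul)\<close> (\<open>entropy_dissipation_fan\<close>).  It is
  linear in \<open>t1\<close>, so \<open>K\<^sub>U + F ur - F ul\<close> is also its rate.

  Both the weak form and the production measure are evaluated by one computation,
  \<open>fan_product_test_integral\<close>, which tests a pair of density and flux with a product \<open>a x * b t\<close> of cutoff
  functions such that the solution is constant on either side wherever \<open>a\<close> varies.
\<close>

section \<open>Continuously differentiable cutoff functions\<close>

text \<open>
  The square of the hinge \<open>max 0 x\<close> is the simplest function that is constant on a half line,
  not constant elsewhere, and still \<open>C\<^sup>1\<close>; all cutoff functions are assembled from it.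
\<close>
lemma DERIV_hinge_square:
  "((\<lambda>x::real. (max 0 x)\<^sup>2) has_real_derivative 2 * max 0 x) (at x)"
proof -
  consider "x < 0" | "x = 0" | "x > 0" by linarith
  then show ?thesis
  proof cases
    case 1
    have "((\<lambda>x::real. 0) has_real_derivative 0) (at x)" by simp
    then have "((\<lambda>x::real. (max 0 x)\<^sup>2) has_real_derivative 0) (at x)"
      by (rule has_field_derivative_transform_within_open[where S="{..<0}"]) (use 1 in \<open>auto simp: max_def\<close>)
    then show ?thesis using 1 by (simp add: max_def)
  next
    case 2
    have "\<forall>z::real. (max 0 z)\<^sup>2 - (max 0 0)\<^sup>2 = max 0 z * (z - 0)"
      by (auto simp: max_def power2_eq_square)
    moreover have "isCont (\<lambda>z::real. max 0 z) 0" by (intro continuous_intros)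
    ultimately have "((\<lambda>x::real. (max 0 x)\<^sup>2) has_real_derivative max 0 0) (at 0)"
      unfolding CARAT_DERIV by (intro exI[of _ "\<lambda>z. max 0 z"]) auto
    then show ?thesis using 2 by simp
  next
    case 3
    have "((\<lambda>x::real. x\<^sup>2) has_real_derivative 2 * x) (at x)"
      by (auto intro!: derivative_eq_intros)
    then have "((\<lambda>x::real. (max 0 x)\<^sup>2) has_real_derivative 2 * x) (at x)"
      by (rule has_field_derivative_transform_within_open[where S="{0<..}"]) (use 3 in \<open>auto simp: max_def\<close>)
    then show ?thesis using 3 by (simp add: max_def)
  qed
qed

definition has_C1_deriv :: "(real \<Rightarrow> real) \<Rightarrow> (real \<Rightarrow> real) \<Rightarrow> bool" where
  "has_C1_deriv g g' \<longleftrightarrow> (\<forall>x. (g has_real_derivative g' x) (at x)) \<and> continuous_on UNIV g'"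

lemma has_C1_derivD:
  assumes "has_C1_deriv g g'"
  shows "(g has_real_derivative g' x) (at x)" "continuous_on S g" "continuous_on S g'"
    "g \<in> borel_measurable borel" "g' \<in> borel_measurable borel"
proof -
  show d: "(g has_real_derivative g' x) (at x)" for x using assms by (simp add: has_C1_deriv_def)
  have c: "continuous_on UNIV g" using d by (meson DERIV_isCont continuous_at_imp_continuous_on)
  then show "continuous_on S g" by (rule continuous_on_subset) simp
  have c': "continuous_on UNIV g'" using assms by (simp add: has_C1_deriv_def)
  then show "continuous_on S g'" by (rule continuous_on_subset) simp
  show "g \<in> borel_measurable borel" "g' \<in> borel_measurable borel"
    using c c' by (auto intro: borel_measurable_continuous_onI)
qed

text \<open>
  For a cutoff function \<open>g\<close> every point of value \<open>0\<close> or \<open>1\<close> is an extremum.  This gives the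
  vanishing of \<open>g'\<close> also at the end points of the plateau and of the support.
\<close>
lemma has_C1_deriv_extremum_zero:
  assumes "has_C1_deriv g g'" "\<And>y. 0 \<le> g y \<and> g y \<le> 1" "g x = 0 \<or> g x = 1"
  shows "g' x = 0"
  using assms(3)
proof
  assume "g x = 0"
  then show ?thesis
    using DERIV_local_min[OF has_C1_derivD(1)[OF assms(1)], of 1 x] assms(2) by simp
next
  assume "g x = 1"
  then show ?thesis
    using DERIV_local_max[OF has_C1_derivD(1)[OF assms(1)], of 1 x] assms(2) by simp
qed

text \<open>
  The quadratic spline with knots \<open>0\<close>, \<open>1/2\<close>, \<open>1\<close> that rises from \<open>0\<close> to \<open>1\<close>.
\<close>
definition ramp :: "real \<Rightarrow> real" where
  "ramp x = 2 * (max 0 x)\<^sup>2 - 4 * (max 0 (x - 1/2))\<^sup>2 + 2 * (max 0 (x - 1))\<^sup>2"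

definition ramp' :: "real \<Rightarrow> real" where
  "ramp' x = 4 * max 0 x - 8 * max 0 (x - 1/2) + 4 * max 0 (x - 1)"

lemma C1_ramp: "has_C1_deriv ramp ramp'"
proof -
  have sh: "((\<lambda>x::real. (max 0 (x - c))\<^sup>2) has_real_derivative 2 * max 0 (x - c)) (at x)" for c x
  proof -
    have "((\<lambda>x. x - c) has_real_derivative 1) (at x)" by (auto intro!: derivative_eq_intros)
    from DERIV_chain2[OF DERIV_hinge_square this] show ?thesis by simp
  qed
  have "(ramp has_real_derivative ramp' x) (at x)" for x
    unfolding ramp_def[abs_def] ramp'_def
    by (rule derivative_eq_intros DERIV_hinge_square sh refl | simp)+
  moreover have "continuous_on UNIV ramp'"
    unfolding ramp'_def by (intro continuous_intros)
  ultimately show ?thesis by (simp add: has_C1_deriv_def)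
qed

lemma ramp_eq_0: "x \<le> 0 \<Longrightarrow> ramp x = 0"
  by (simp add: ramp_def max_def)

lemma ramp_eq_1: "1 \<le> x \<Longrightarrow> ramp x = 1"
  by (simp add: ramp_def max_def power2_eq_square algebra_simps)

lemma ramp_range: "0 \<le> ramp x" "ramp x \<le> 1"
proof -
  consider "x \<le> 0" | "0 < x" "x \<le> 1/2" | "1/2 < x" "x \<le> 1" | "1 < x" by linarith
  then have "0 \<le> ramp x \<and> ramp x \<le> 1"
  proof cases
    case 2
    then have "x\<^sup>2 \<le> (1/2)\<^sup>2" by (intro power_mono) auto
    moreover have "ramp x = 2 * x\<^sup>2" using 2 by (simp add: ramp_def max_def)
    ultimately show ?thesis by (simp add: power2_eq_square)
  next
    case 3
    then have "(1 - x)\<^sup>2 \<le> (1/2)\<^sup>2" by (intro power_mono) auto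
    moreover have "ramp x = 1 - 2 * (1 - x)\<^sup>2"
      using 3 by (simp add: ramp_def max_def power2_eq_square algebra_simps)
    ultimately show ?thesis by (simp add: power2_eq_square)
  qed (auto simp: ramp_eq_0 ramp_eq_1)
  then show "0 \<le> ramp x" "ramp x \<le> 1" by auto
qed

text \<open>
  For \<open>2 * e < d - c\<close> the support is \<open>[c, d]\<close> and the plateau of value \<open>1\<close> is \<open>[c + e, d - e]\<close>: the width \<open>e\<close> of the two
  transition layers lies inside \<open>[c, d]\<close>, so that cutoffs stay below the indicator of \<open>(c, d)\<close>.
\<close>
definition cutoff :: "real \<Rightarrow> real \<Rightarrow> real \<Rightarrow> real \<Rightarrow> real" where
  "cutoff c d e x = ramp ((x - c) / e) * ramp ((d - x) / e)"

lemma cutoff_C1: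
  assumes "e > 0"
  obtains g' where "has_C1_deriv (cutoff c d e) g'"
proof -
  let ?g = "\<lambda>x. ramp' ((x - c) / e) * (1 / e) * ramp ((d - x) / e) +
       ramp' ((d - x) / e) * (- 1 / e) * ramp ((x - c) / e)"
  note r = has_C1_derivD[OF C1_ramp]
  have "(cutoff c d e has_real_derivative ?g x) (at x)" for x
    unfolding cutoff_def[abs_def]
  proof (rule DERIV_mult)
    have "((\<lambda>x. (x - c) / e) has_real_derivative 1 / e) (at x)"
      using \<open>e > 0\<close> by (auto intro!: derivative_eq_intros simp: field_simps)
    from DERIV_chain2[OF r(1) this]
    show "((\<lambda>x. ramp ((x - c) / e)) has_real_derivative ramp' ((x - c) / e) * (1 / e)) (at x)" .
    have "((\<lambda>x. (d - x) / e) has_real_derivative - 1 / e) (at x)"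
      using \<open>e > 0\<close> by (auto intro!: derivative_eq_intros simp: field_simps)
    from DERIV_chain2[OF r(1) this]
    show "((\<lambda>x. ramp ((d - x) / e)) has_real_derivative ramp' ((d - x) / e) * (- 1 / e)) (at x)" .
  qed
  moreover have "continuous_on UNIV ?g"
    unfolding divide_inverse
    by (intro continuous_intros continuous_on_compose2[OF r(2)[of UNIV]]
          continuous_on_compose2[OF r(3)[of UNIV]]) auto
  ultimately have "has_C1_deriv (cutoff c d e) ?g" unfolding has_C1_deriv_def by blast
  then show ?thesis by (rule that)
qed

lemma cutoff_range: "0 \<le> cutoff c d e x \<and> cutoff c d e x \<le> 1"
  unfolding cutoff_def by (simp add: ramp_range mult_le_one)

lemma cutoff_eq_0: "e > 0 \<Longrightarrow> x \<notin> {c<..<d} \<Longrightarrow> cutoff c d e x = 0"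
  by (auto simp: cutoff_def ramp_eq_0 divide_nonpos_pos not_less)

lemma cutoff_eq_1: "e > 0 \<Longrightarrow> x \<in> {c + e..d - e} \<Longrightarrow> cutoff c d e x = 1"
  by (auto simp: cutoff_def ramp_eq_1)

text \<open>
  Tensor products are the only test functions that the argument uses.  The inclusion of the
  support in a strip \<open>S \<le> t \<le> T\<close> is what makes them admissible for a distribution on \<open>t > 0\<close>.
\<close>
lemma product_test_function:
  assumes a: "has_C1_deriv a a'" and b: "has_C1_deriv b b'"
    and a0: "\<And>x. x \<notin> {-R<..<R} \<Longrightarrow> a x = 0" and b0: "\<And>t. t \<notin> {S<..<T} \<Longrightarrow> b t = 0"
  shows "test_function (\<lambda>(x, t). a x * b t)"
    and "partial_x (\<lambda>(x, t). a x * b t) (x, t) = a' x * b t"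
    and "partial_t (\<lambda>(x, t). a x * b t) (x, t) = a x * b' t"
    and "closure {p. (\<lambda>(x, t). a x * b t) p \<noteq> 0} \<subseteq> UNIV \<times> {S..T}"
proof -
  show px: "partial_x (\<lambda>(x, t). a x * b t) (x, t) = a' x * b t" for x t
    unfolding partial_x_def by (auto intro!: DERIV_imp_deriv DERIV_cmult_right has_C1_derivD(1)[OF a])
  show pt: "partial_t (\<lambda>(x, t). a x * b t) (x, t) = a x * b' t" for x t
    unfolding partial_t_def by (auto intro!: DERIV_imp_deriv DERIV_cmult has_C1_derivD(1)[OF b])
  let ?K = "{-R..R} \<times> {S..T}"
  have sub: "closure {p. (\<lambda>(x, t). a x * b t) p \<noteq> 0} \<subseteq> ?K"
  proof (rule closure_minimal)
    show "{p. (\<lambda>(x, t). a x * b t) p \<noteq> 0} \<subseteq> ?K"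
    proof
      fix p assume "p \<in> {p. (\<lambda>(x, t). a x * b t) p \<noteq> 0}"
      then have "a (fst p) \<noteq> 0" "b (snd p) \<noteq> 0" by (auto simp: case_prod_beta)
      then have "fst p \<in> {-R<..<R}" "snd p \<in> {S<..<T}" using a0 b0 by blast+
      then show "p \<in> ?K" by (cases p) auto
    qed
  qed (auto intro: closed_Times)
  then show "closure {p. (\<lambda>(x, t). a x * b t) p \<noteq> 0} \<subseteq> UNIV \<times> {S..T}" by auto
  have diff: "(\<lambda>(x, t). a x * b t) differentiable_on UNIV"
  proof -
    have "(\<lambda>p. a (fst p) * b (snd p)) differentiable (at q)" for q
    proof (rule differentiable_mult)
      have "a differentiable (at (fst q))" "b differentiable (at (snd q))"
        using has_C1_derivD(1)[OF a] has_C1_derivD(1)[OF b] real_differentiable_def by blast+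
      then show "(\<lambda>p. a (fst p)) differentiable (at q)" "(\<lambda>p. b (snd p)) differentiable (at q)"
        using differentiable_chain_at[of fst q a] differentiable_chain_at[of snd q b]
        by (simp_all add: o_def bounded_linear_imp_differentiable bounded_linear_fst bounded_linear_snd)
    qed
    moreover have "(\<lambda>(x, t). a x * b t) = (\<lambda>p. a (fst p) * b (snd p))" by auto
    ultimately show ?thesis by (simp only: differentiable_on_def differentiable_at_withinI) blast
  qed
  have eqs: "partial_x (\<lambda>(x, t). a x * b t) = (\<lambda>p. a' (fst p) * b (snd p))"
    "partial_t (\<lambda>(x, t). a x * b t) = (\<lambda>p. a (fst p) * b' (snd p))"
    using px pt by auto
  have cont: "continuous_on UNIV (partial_x (\<lambda>(x, t). a x * b t))"
    "continuous_on UNIV (partial_t (\<lambda>(x, t). a x * b t))"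
    unfolding eqs
    by (intro continuous_intros continuous_on_compose2[OF has_C1_derivD(2)[OF a, of UNIV]]
        continuous_on_compose2[OF has_C1_derivD(2)[OF b, of UNIV]]
        continuous_on_compose2[OF has_C1_derivD(3)[OF a, of UNIV]]
        continuous_on_compose2[OF has_C1_derivD(3)[OF b, of UNIV]]; simp)+
  have "compact (closure {p. (\<lambda>(x, t). a x * b t) p \<noteq> 0})"
    using closed_Int_compact[OF closed_closure, of ?K] compact_Times[of "{-R..R}" "{S..T}"] sub
    by (metis compact_Icc inf.absorb1)
  then show "test_function (\<lambda>(x, t). a x * b t)"
    unfolding test_function_def using diff cont by blast
qed

section \<open>Fans\<close>

definition step :: "'b \<Rightarrow> 'b \<Rightarrow> real \<Rightarrow> 'b" where
  "step vl vr x = (if x < 0 then vl else vr)"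

text \<open>
  The growth, per unit time, of the integral of the self-similar \<open>w (x / t)\<close> over that of its initial data.
  Subtracting the step makes the integral over the whole line converge for every locally integrable fan.
\<close>
definition excess :: "'b \<Rightarrow> 'b \<Rightarrow> (real \<Rightarrow> 'b) \<Rightarrow> 'b::euclidean_space" where
  "excess vl vr w = (LINT y | lborel. w y - step vl vr y)"

text \<open>
  The profile at time \<open>1\<close> of a self-similar solution with signal speeds at most \<open>m\<close>.  The
  values at \<open>- m\<close> and \<open>m\<close> are arbitrary; as null sets these points drop out of all integrals.
\<close>
definition fan :: "real \<Rightarrow> 'b \<Rightarrow> 'b \<Rightarrow> (real \<Rightarrow> 'b) \<Rightarrow> bool" where
  "fan m vl vr w \<longleftrightarrow> (\<forall>y < -m. w y = vl) \<and> (\<forall>y > m. w y = vr)"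

lemma fan_scaled_eq_step:
  assumes "fan m vl vr w" "0 \<le> m" "0 < t" "t * m < \<bar>x\<bar>"
  shows "w (x / t) = step vl vr x"
proof (cases "x < 0")
  case True
  then have "x / t < - m" using assms(3,4) by (simp add: field_simps)
  then show ?thesis using True assms(1) by (simp add: fan_def step_def)
next
  case False
  then have "m < x / t" using assms(3,4) by (simp add: field_simps)
  then show ?thesis using False assms(1) by (simp add: fan_def step_def)
qed

text \<open>
  The step is invariant under dilations, so the surplus at time \<open>t\<close> is the surplus at time \<open>1\<close>
  stretched by the factor \<open>t\<close>.  This is the only source of linearity in \<open>t\<close>.
\<close>
lemma excess_scaled:
  fixes w :: "real \<Rightarrow> 'b::euclidean_space"
  assumes int: "integrable lborel (\<lambda>y. w y - step vl vr y)" and "0 < t"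
  shows "has_bochner_integral lborel (\<lambda>x. w (x / t) - step vl vr x) (t *\<^sub>R excess vl vr w)"
proof -
  have "has_bochner_integral lborel (\<lambda>y. w y - step vl vr y) (excess vl vr w)"
    using int by (simp add: has_bochner_integral_iff excess_def)
  then have "has_bochner_integral lborel (\<lambda>x. w (0 + (1 / t) * x) - step vl vr (0 + (1 / t) * x))
      (excess vl vr w /\<^sub>R \<bar>1 / t\<bar>)"
    using \<open>0 < t\<close> by (subst (asm) lborel_has_bochner_integral_real_affine_iff[of "1 / t" _ _ 0]) simp_all
  moreover have "step vl vr ((1 / t) * x) = step vl vr x" for x
    using \<open>0 < t\<close> by (simp add: step_def field_simps)
  ultimately show ?thesis using \<open>0 < t\<close> by simp
qed

lemma has_bochner_integral_const_on:
  fixes c :: "'b::euclidean_space"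
  assumes "A \<in> sets M" "emeasure M A < \<infinity>"
  shows "has_bochner_integral M (\<lambda>x. indicator A x *\<^sub>R c) (measure M A *\<^sub>R c)"
  using assms by (intro has_bochner_integral_scaleR_left has_bochner_integral_real_indicator)

lemma step_integral:
  fixes vl vr :: "'b::euclidean_space"
  assumes "0 \<le> M"
  shows "has_bochner_integral lborel (\<lambda>x. indicator {-M<..<M} x *\<^sub>R step vl vr x) (M *\<^sub>R (vl + vr))"
proof -
  have "has_bochner_integral lborel
      (\<lambda>x. indicator {-M<..<0} x *\<^sub>R vl + indicator {0..<M} x *\<^sub>R vr)
      (measure lborel {-M<..<0} *\<^sub>R vl + measure lborel {0..<M} *\<^sub>R vr)"
    by (intro has_bochner_integral_add has_bochner_integral_const_on) (use assms in auto)
  moreover have "indicator {-M<..<0} x *\<^sub>R vl + indicator {0..<M} x *\<^sub>R vr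
      = indicator {-M<..<M} x *\<^sub>R step vl vr x" for x
    using assms by (auto simp: step_def indicator_def)
  ultimately show ?thesis using assms by (simp add: scaleR_add_right)
qed

text \<open>
  As long as the fan has not left \<open>(-M, M)\<close>, the interval contains the whole surplus \<open>t * excess\<close> in
  addition to the initial contents \<open>M * (vl + vr)\<close>.
\<close>
lemma fan_total:
  fixes w :: "real \<Rightarrow> 'b::euclidean_space"
  assumes fan: "fan m vl vr w" and m: "0 \<le> m"
    and int: "integrable lborel (\<lambda>y. w y - step vl vr y)" and t: "0 < t" "t * m \<le> M"
  shows "has_bochner_integral lborel (\<lambda>x. indicator {-M<..<M} x *\<^sub>R w (x / t))
           (t *\<^sub>R excess vl vr w + M *\<^sub>R (vl + vr))"
proof -
  have M: "0 \<le> M" using m t by (meson mult_nonneg_nonneg less_imp_le order_trans)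
  have "has_bochner_integral lborel
      (\<lambda>x. (w (x / t) - step vl vr x) + indicator {-M<..<M} x *\<^sub>R step vl vr x)
      (t *\<^sub>R excess vl vr w + M *\<^sub>R (vl + vr))"
    by (intro has_bochner_integral_add excess_scaled int t step_integral M)
  then show ?thesis
  proof (subst has_bochner_integral_discrete_difference[where X = "{-M, M}"])
    fix x :: real assume "x \<notin> {-M, M}"
    then show "indicator {-M<..<M} x *\<^sub>R w (x / t)
        = (w (x / t) - step vl vr x) + indicator {-M<..<M} x *\<^sub>R step vl vr x"
      using fan_scaled_eq_step[OF fan m t(1), of x] t(2) by (auto simp: indicator_def)
  qed auto
qed

lemma fan_integrable_excess:
  fixes w :: "real \<Rightarrow> 'b::euclidean_space"
  assumes fan: "fan m vl vr w" and m: "0 \<le> m" "m \<le> M"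
    and int: "integrable lborel (\<lambda>x. indicator {-M<..<M} x *\<^sub>R w x)"
  shows "integrable lborel (\<lambda>y. w y - step vl vr y)"
proof -
  have "integrable lborel (\<lambda>x. indicator {-M<..<M} x *\<^sub>R w x - indicator {-M<..<M} x *\<^sub>R step vl vr x)"
    using int step_integral[of M vl vr] m by (intro Bochner_Integration.integrable_diff) (auto simp: has_bochner_integral_iff)
  then show ?thesis
  proof (subst integrable_discrete_difference[where X = "{-M, M}"])
    fix x :: real assume "x \<notin> {-M, M}"
    then show "w x - step vl vr x
        = indicator {-M<..<M} x *\<^sub>R w x - indicator {-M<..<M} x *\<^sub>R step vl vr x"
      using fan_scaled_eq_step[OF fan m(1), of 1 x] m(2) by (auto simp: indicator_def)
  qed auto
qed

text \<open>
  With separate speed bounds \<open>al\<close> and \<open>ar\<close> the surplus can be read off from the integral over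
  \<open>[al, ar]\<close> alone.  Both sides are compared on an interval \<open>(-M, M)\<close>
  around \<open>[al, ar]\<close> and \<open>0\<close>, which treats all signs of \<open>al\<close> and \<open>ar\<close> at once.
\<close>
lemma integral_between_signals:
  fixes w :: "real \<Rightarrow> 'b::euclidean_space"
  assumes int: "integrable lborel (\<lambda>y. w y - step vl vr y)" and "al \<le> ar"
    and left: "\<And>y. y < al \<Longrightarrow> w y = vl" and right: "\<And>y. ar < y \<Longrightarrow> w y = vr"
  shows "has_bochner_integral lborel (\<lambda>y. indicator {al..ar} y *\<^sub>R w y)
           (excess vl vr w - al *\<^sub>R vl + ar *\<^sub>R vr)"
proof -
  define M where "M = max \<bar>al\<bar> \<bar>ar\<bar> + 1"
  have M: "-M < al" "ar < M" "0 \<le> M" by (auto simp: M_def)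
  have fan: "fan M vl vr w" using left right M by (simp add: fan_def)
  have "has_bochner_integral lborel (\<lambda>y. indicator {-M<..<M} y *\<^sub>R w (y / 1)
        - indicator {-M<..<al} y *\<^sub>R vl - indicator {ar<..<M} y *\<^sub>R vr)
      ((1 *\<^sub>R excess vl vr w + M *\<^sub>R (vl + vr))
        - measure lborel {-M<..<al} *\<^sub>R vl - measure lborel {ar<..<M} *\<^sub>R vr)"
    by (intro has_bochner_integral_diff has_bochner_integral_const_on fan_total[OF fan M(3) int])
      (use M in auto)
  moreover have "indicator {-M<..<M} y *\<^sub>R w (y / 1)
        - indicator {-M<..<al} y *\<^sub>R vl - indicator {ar<..<M} y *\<^sub>R vr = indicator {al..ar} y *\<^sub>R w y" for y
    using M left[of y] right[of y] \<open>al \<le> ar\<close> by (auto simp: indicator_def)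
  ultimately show ?thesis using M by (simp add: algebra_simps)
qed

text \<open>
  Fubini's theorem gives integrability in \<open>x\<close> for almost every time only; by self-similarity one
  such time \<open>t \<in> (0, 1)\<close> is enough, as the profile at time \<open>1\<close> is obtained from it by a dilation.
\<close>
lemma locally_integrable_profile:
  fixes v :: "real \<Rightarrow> real \<Rightarrow> 'b::euclidean_space"
  assumes li: "locally_integrable v" and v: "\<And>x t. 0 < t \<Longrightarrow> v x t = w (x / t)" and "0 < r"
  shows "integrable lborel (\<lambda>x. indicator {-r<..<r} x *\<^sub>R w x)"
proof -
  let ?K = "{-r..r} \<times> {0..1::real}"
  have "compact ?K" by (intro compact_Times) auto
  then have "set_integrable lborel ?K (\<lambda>(x, t). v x t)"
    using li unfolding locally_integrable_def by auto
  then have "integrable (lborel \<Otimes>\<^sub>M lborel) (\<lambda>(x, t). indicator ?K (x, t) *\<^sub>R v x t)"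
    by (simp add: set_integrable_def lborel_prod case_prod_unfold)
  then have "AE t in lborel. integrable lborel (\<lambda>x. indicator ?K (x, t) *\<^sub>R v x t)"
    by (rule lborel_pair.AE_integrable_snd)
  then have "\<exists>t. t \<in> {0<..<1} \<and> integrable lborel (\<lambda>x. indicator ?K (x, t) *\<^sub>R v x t)"
  proof (rule contrapos_pp)
    assume *: "\<nexists>t. t \<in> {0<..<1} \<and> integrable lborel (\<lambda>x. indicator ?K (x, t) *\<^sub>R v x t)"
    show "\<not> (AE t in lborel. integrable lborel (\<lambda>x. indicator ?K (x, t) *\<^sub>R v x t))"
    proof
      assume "AE t in lborel. integrable lborel (\<lambda>x. indicator ?K (x, t) *\<^sub>R v x t)"
      then have "AE t in lborel. t \<notin> {0<..<1::real}" by eventually_elim (use * in auto)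
      then have "emeasure lborel {0<..<1::real} = 0"
        by (subst (asm) AE_iff_measurable[where N = "{0<..<1}"]) auto
      then show False by simp
    qed
  qed
  then obtain t where t: "0 < t" "t < 1"
    and it: "integrable lborel (\<lambda>x. indicator ?K (x, t) *\<^sub>R v x t)" by auto
  \<comment> \<open>Dilating by \<open>1 / t > 1\<close> enlarges the interval \<open>[-r, r]\<close>, so nothing of it is lost.\<close>
  have "integrable lborel (\<lambda>y. indicator ?K (0 + t * y, t) *\<^sub>R v (0 + t * y) t)"
    using it t by (subst lborel_integrable_real_affine_iff) auto
  then have "integrable lborel (\<lambda>y. indicator {-r<..<r} y *\<^sub>R (indicator ?K (0 + t * y, t) *\<^sub>R v (0 + t * y) t))"
    by (intro integrable_mult_indicator) auto
  moreover have "indicator {-r<..<r} y *\<^sub>R (indicator ?K (0 + t * y, t) *\<^sub>R v (0 + t * y) t)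
      = indicator {-r<..<r} y *\<^sub>R w y" for y
  proof -
    have "\<bar>t * y\<bar> \<le> 1 * r" if "y \<in> {-r<..<r}"
      unfolding abs_mult using that t by (intro mult_mono) auto
    then show ?thesis using t by (auto simp: indicator_def v abs_le_iff)
  qed
  ultimately show ?thesis by simp
qed

text \<open>
  The weight is bounded with compact support in \<open>t \<ge> 0\<close>, which makes Fubini's theorem available for
  the space-time integrals of weak forms.
\<close>
lemma locally_integrable_weighted:
  fixes v :: "real \<Rightarrow> real \<Rightarrow> 'b::euclidean_space"
  assumes li: "locally_integrable v" and c: "continuous_on UNIV \<alpha>" "continuous_on UNIV \<beta>"
    and \<alpha>0: "\<And>x. x \<notin> {-R<..<R} \<Longrightarrow> \<alpha> x = 0" and \<beta>0: "\<And>t. T \<le> t \<Longrightarrow> \<beta> t = (0::real)"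
  shows "integrable (lborel \<Otimes>\<^sub>M lborel) (\<lambda>(x, t). (indicator {0<..} t * \<alpha> x * \<beta> t) *\<^sub>R v x t)"
proof -
  let ?K = "{-R..R} \<times> {0..T}"
  have K: "compact ?K" by (intro compact_Times) auto
  have "continuous_on ?K (\<lambda>p. \<alpha> (fst p) * \<beta> (snd p))"
    by (intro continuous_intros continuous_on_compose2[OF c(1)] continuous_on_compose2[OF c(2)]) auto
  then have "bounded ((\<lambda>p. \<alpha> (fst p) * \<beta> (snd p)) ` ?K)"
    by (intro compact_imp_bounded compact_continuous_image K)
  then obtain B where "\<forall>y \<in> (\<lambda>p. \<alpha> (fst p) * \<beta> (snd p)) ` ?K. norm y \<le> B"
    unfolding bounded_iff by blast
  then have B: "\<bar>\<alpha> (fst p) * \<beta> (snd p)\<bar> \<le> B" if "p \<in> ?K" for p using that by auto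
  have [measurable]: "\<alpha> \<in> borel_measurable borel" "\<beta> \<in> borel_measurable borel"
    using c by (auto intro: borel_measurable_continuous_onI)
  have "set_integrable lborel ?K (\<lambda>(x, t). v x t)"
    using li K unfolding locally_integrable_def by auto
  then have int: "integrable (lborel \<Otimes>\<^sub>M lborel) (\<lambda>p. indicator ?K p *\<^sub>R v (fst p) (snd p))"
    by (simp add: set_integrable_def lborel_prod case_prod_beta)
  note [measurable] = borel_measurable_integrable[OF int]
  let ?g = "\<lambda>p. (indicator {0<..} (snd p) * \<alpha> (fst p) * \<beta> (snd p)) *\<^sub>R (indicator ?K p *\<^sub>R v (fst p) (snd p))"
  have "integrable (lborel \<Otimes>\<^sub>M lborel) (\<lambda>p. B *\<^sub>R (indicator ?K p *\<^sub>R v (fst p) (snd p)))"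
    by (intro integrable_scaleR_right int)
  then have "integrable (lborel \<Otimes>\<^sub>M lborel) ?g"
  proof (rule Bochner_Integration.integrable_bound)
    show "?g \<in> borel_measurable (lborel \<Otimes>\<^sub>M lborel)" by measurable
    show "AE p in lborel \<Otimes>\<^sub>M lborel. norm (?g p) \<le> norm (B *\<^sub>R (indicator ?K p *\<^sub>R v (fst p) (snd p)))"
    proof (rule AE_I2)
      fix p :: "real \<times> real"
      show "norm (?g p) \<le> norm (B *\<^sub>R (indicator ?K p *\<^sub>R v (fst p) (snd p)))"
      proof (cases "p \<in> ?K")
        case True
        have "\<bar>indicator {0<..} (snd p) * (\<alpha> (fst p) * \<beta> (snd p))\<bar> \<le> \<bar>B\<bar>"
          using B[OF True] by (auto simp: indicator_def)
        moreover have "indicator ?K p = (1::real)" using True by (rule indicator_simps)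
        ultimately show ?thesis by (simp add: mult.assoc mult_right_mono)
      qed simp
    qed
  qed
  moreover have "?g = (\<lambda>(x, t). (indicator {0<..} t * \<alpha> x * \<beta> t) *\<^sub>R v x t)"
  proof (rule ext)
    fix p :: "real \<times> real"
    have "\<alpha> (fst p) = 0 \<or> \<beta> (snd p) = 0 \<or> snd p \<le> 0" if "p \<notin> ?K"
      using that \<alpha>0[of "fst p"] \<beta>0[of "snd p"] by (cases p) force
    then show "?g p = (\<lambda>(x, t). (indicator {0<..} t * \<alpha> x * \<beta> t) *\<^sub>R v x t) p"
      by (cases "p \<in> ?K") (auto simp: case_prod_beta)
  qed
  ultimately show ?thesis by simp
qed

section \<open>Testing a fan with a tensor product\<close>

text \<open>
  On the left half line \<open>a'\<close> has total integral \<open>1\<close>, on the right half line \<open>-1\<close>.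
\<close>
lemma transition_integral:
  fixes hl hr :: "'b::euclidean_space"
  assumes a: "has_C1_deriv a a'" and range: "\<And>x. 0 \<le> a x \<and> a x \<le> 1"
    and "0 < R" and a0: "\<And>x. x \<notin> {-R<..<R} \<Longrightarrow> a x = 0" and "a 0 = 1"
  shows "has_bochner_integral lborel (\<lambda>x. a' x *\<^sub>R step hl hr x) (hl - hr)"
proof -
  note z = has_C1_deriv_extremum_zero[OF a range]
  have FTC: "has_bochner_integral lborel (\<lambda>x. indicator {p..q} x *\<^sub>R (a' x *\<^sub>R c)) (a q *\<^sub>R c - a p *\<^sub>R c)"
    if "p \<le> q" for p q and c :: 'b
  proof (rule has_bochner_integral_FTC_Icc[OF that])
    fix x
    have "(a has_real_derivative a' x) (at x within {p..q})"
      by (rule has_field_derivative_at_within[OF has_C1_derivD(1)[OF a]])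
    then show "((\<lambda>x. a x *\<^sub>R c) has_vector_derivative a' x *\<^sub>R c) (at x within {p..q})"
      by (auto intro!: derivative_eq_intros)
  qed (intro continuous_intros has_C1_derivD(3)[OF a])
  have "has_bochner_integral lborel
      (\<lambda>x. indicator {-R..0} x *\<^sub>R (a' x *\<^sub>R hl) + indicator {0..R} x *\<^sub>R (a' x *\<^sub>R hr))
      ((a 0 *\<^sub>R hl - a (-R) *\<^sub>R hl) + (a R *\<^sub>R hr - a 0 *\<^sub>R hr))"
    by (intro has_bochner_integral_add FTC) (use \<open>0 < R\<close> in auto)
  moreover have "indicator {-R..0} x *\<^sub>R (a' x *\<^sub>R hl) + indicator {0..R} x *\<^sub>R (a' x *\<^sub>R hr)
      = a' x *\<^sub>R step hl hr x" for x
  proof (cases "x = 0 \<or> x \<notin> {-R<..<R}")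
    case True
    then have "a' x = 0" using z[of x] a0[of x] \<open>a 0 = 1\<close> by auto
    then show ?thesis by simp
  next
    case False
    then show ?thesis by (auto simp: step_def indicator_def)
  qed
  ultimately show ?thesis using a0[of R] a0[of "-R"] \<open>a 0 = 1\<close> by simp
qed

text \<open>
  The central computation.  While \<open>b\<close> is alive, that is for \<open>t < T\<close>, the fan stays inside the plateau
  \<open>[-R, R]\<close> of \<open>a\<close>.  Hence \<open>a\<close> sees the complete surplus of \<open>v\<close>, and the integral of \<open>a * v\<close> over
  \<open>x\<close> is \<open>C + t * excess\<close>; on the other hand \<open>a'\<close> sees only the constant states of \<open>h\<close>, and the
  integral of \<open>a' * h\<close> is \<open>hl - hr\<close>.  What remains is an integration by parts in \<open>t\<close>.  Apart
  from the boundary term at \<open>t = 0\<close>, the result is the integral of \<open>b\<close> times \<open>excess - (hl - hr)\<close> up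
  to sign, and this factor is the production of \<open>v\<close> in unit time.
\<close>
lemma fan_product_test_integral:
  fixes v h :: "real \<Rightarrow> real \<Rightarrow> 'b::euclidean_space"
  assumes v: "\<And>x t. 0 < t \<Longrightarrow> v x t = w (x / t)" and h: "\<And>x t. 0 < t \<Longrightarrow> h x t = k (x / t)"
    and fans: "fan m vl vr w" "fan m hl hr k" and m: "0 < m"
    and li: "locally_integrable v" "locally_integrable h"
    and a: "has_C1_deriv a a'" and a_range: "\<And>x. 0 \<le> a x \<and> a x \<le> 1"
    and a0: "\<And>x. x \<notin> {-R'<..<R'} \<Longrightarrow> a x = 0" and a1: "\<And>x. x \<in> {-R..R} \<Longrightarrow> a x = 1"
    and b: "has_C1_deriv b b'" and b_range: "\<And>t. 0 \<le> b t \<and> b t \<le> 1"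
    and b0: "\<And>t. T \<le> t \<Longrightarrow> b t = 0"
    and T: "0 < T" "T * m \<le> R"
  shows "(LINT (x, t) : UNIV \<times> {0<..} | lborel. (a x * b' t) *\<^sub>R v x t + (a' x * b t) *\<^sub>R h x t)
       = - (b 0 *\<^sub>R (LINT x | lborel. a x *\<^sub>R step vl vr x))
         - (LINT t | lborel. indicator {0..T} t * b t) *\<^sub>R (excess vl vr w - (hl - hr))"
proof -
  define C where "C = (LINT x | lborel. a x *\<^sub>R step vl vr x)"
  define K where "K = excess vl vr w"
  have R: "0 < R" using T m by (meson mult_pos_pos less_le_trans)
  have "0 < R'"
  proof (rule ccontr)
    assume "\<not> 0 < R'"
    then have "a 0 = 0" by (intro a0) auto
    then show False using a1[of 0] R by simp
  qed
  note za = has_C1_deriv_extremum_zero[OF a a_range]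
  have a'0: "x \<notin> {-R'<..<R'} \<Longrightarrow> a' x = 0" for x using za a0 by blast
  have b'0: "T \<le> t \<Longrightarrow> b' t = 0" for t using has_C1_deriv_extremum_zero[OF b b_range] b0 by blast

  have int_w: "integrable lborel (\<lambda>y. w y - step vl vr y)"
    by (rule fan_integrable_excess[OF fans(1) _ order_refl locally_integrable_profile[OF li(1) v m]])
      (use m in auto)
  have [measurable]: "a \<in> borel_measurable borel" by (rule has_C1_derivD[OF a])
  have [measurable]: "step vl vr \<in> borel_measurable borel"
    unfolding step_def[abs_def] by measurable
  have int_a: "integrable lborel (\<lambda>x. a x *\<^sub>R step vl vr x)"
  proof (rule Bochner_Integration.integrable_bound)
    show "integrable lborel (\<lambda>x. indicator {-R'<..<R'} x *\<^sub>R step vl vr x)"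
      using step_integral[of R' vl vr] \<open>0 < R'\<close> by (simp add: has_bochner_integral_iff)
    show "AE x in lborel. norm (a x *\<^sub>R step vl vr x) \<le> norm (indicator {-R'<..<R'} x *\<^sub>R step vl vr x)"
    proof (rule AE_I2)
      fix x
      have "\<bar>a x\<bar> \<le> indicator {-R'<..<R'} x"
        using a_range[of x] a0[of x] by (cases "x \<in> {-R'<..<R'}") auto
      then show "norm (a x *\<^sub>R step vl vr x) \<le> norm (indicator {-R'<..<R'} x *\<^sub>R step vl vr x)"
        by (auto intro!: mult_right_mono)
    qed
  qed measurable

  \<comment> \<open>Where \<open>a\<close> differs from \<open>1\<close>, the solution has its initial value: the surplus is not cut.\<close>
  have inner_v: "has_bochner_integral lborel (\<lambda>x. a x *\<^sub>R v x t) (C + t *\<^sub>R K)" if t: "0 < t" "t < T" for t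
  proof -
    have "has_bochner_integral lborel (\<lambda>x. a x *\<^sub>R step vl vr x + (w (x / t) - step vl vr x)) (C + t *\<^sub>R K)"
      unfolding C_def K_def using int_a
      by (intro has_bochner_integral_add excess_scaled int_w t) (simp add: has_bochner_integral_iff)
    moreover have "a x *\<^sub>R step vl vr x + (w (x / t) - step vl vr x) = a x *\<^sub>R v x t" for x
    proof (cases "x \<in> {-R..R}")
      case True
      then show ?thesis using a1[of x] v[OF t(1)] by simp
    next
      case False
      have "t * m < T * m" using t m by simp
      then have "t * m < \<bar>x\<bar>" using False T by auto
      then show ?thesis using fan_scaled_eq_step[OF fans(1) _ t(1), of x] m v[OF t(1)] by simp
    qed
    ultimately show ?thesis by simp
  qed
  have inner_h: "has_bochner_integral lborel (\<lambda>x. a' x *\<^sub>R h x t) (hl - hr)" if t: "0 < t" "t < T" for t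
  proof -
    have "a' x *\<^sub>R step hl hr x = a' x *\<^sub>R h x t" for x
    proof (cases "x \<in> {-R..R}")
      case True
      then show ?thesis using a1[of x] za[of x] by simp
    next
      case False
      have "t * m < T * m" using t m by simp
      then have "t * m < \<bar>x\<bar>" using False T by auto
      then show ?thesis using fan_scaled_eq_step[OF fans(2) _ t(1), of x] m h[OF t(1)] by simp
    qed
    moreover have "has_bochner_integral lborel (\<lambda>x. a' x *\<^sub>R step hl hr x) (hl - hr)"
      by (rule transition_integral[OF a a_range \<open>0 < R'\<close> a0]) (use a1[of 0] R in auto)
    ultimately show ?thesis by (simp only:)
  qed

  let ?G = "\<lambda>x t. (indicator {0<..} t * a x * b' t) *\<^sub>R v x t + (indicator {0<..} t * a' x * b t) *\<^sub>R h x t"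
  have "integrable (lborel \<Otimes>\<^sub>M lborel) (\<lambda>(x, t). (indicator {0<..} t * a x * b' t) *\<^sub>R v x t)"
    using a0 b'0 by (intro locally_integrable_weighted[OF li(1)] has_C1_derivD(2)[OF a] has_C1_derivD(3)[OF b])
  moreover have "integrable (lborel \<Otimes>\<^sub>M lborel) (\<lambda>(x, t). (indicator {0<..} t * a' x * b t) *\<^sub>R h x t)"
    using a'0 b0 by (intro locally_integrable_weighted[OF li(2)] has_C1_derivD(3)[OF a] has_C1_derivD(2)[OF b])
  ultimately have int_G: "integrable (lborel \<Otimes>\<^sub>M lborel) (\<lambda>(x, t). ?G x t)"
    unfolding case_prod_unfold by (rule Bochner_Integration.integrable_add)
  have "(LINT (x, t) : UNIV \<times> {0<..} | lborel. (a x * b' t) *\<^sub>R v x t + (a' x * b t) *\<^sub>R h x t)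
      = integral\<^sup>L (lborel \<Otimes>\<^sub>M lborel) (\<lambda>(x, t). ?G x t)"
    unfolding set_lebesgue_integral_def lborel_prod
    by (intro Bochner_Integration.integral_cong)
      (simp_all add: case_prod_unfold indicator_times scaleR_add_right mult.assoc)
  also have "\<dots> = (LINT t | lborel. LINT x | lborel. ?G x t)"
    using lborel_pair.integral_snd[OF int_G] by simp
  also have "\<dots> = (LINT t | lborel. indicator {0..T} t *\<^sub>R (b' t *\<^sub>R (C + t *\<^sub>R K) + b t *\<^sub>R (hl - hr)))"
  proof (rule integral_discrete_difference[where X = "{0}"])
    fix t :: real assume "t \<notin> {0}"
    then consider "t < 0" | "0 < t" "t < T" | "T \<le> t" by force
    then show "(LINT x | lborel. ?G x t)
        = indicator {0..T} t *\<^sub>R (b' t *\<^sub>R (C + t *\<^sub>R K) + b t *\<^sub>R (hl - hr))"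
    proof cases
      case 2
      have "has_bochner_integral lborel (\<lambda>x. b' t *\<^sub>R (a x *\<^sub>R v x t) + b t *\<^sub>R (a' x *\<^sub>R h x t))
          (b' t *\<^sub>R (C + t *\<^sub>R K) + b t *\<^sub>R (hl - hr))"
        by (intro has_bochner_integral_add has_bochner_integral_scaleR_right inner_v inner_h 2)
      then show ?thesis
        using 2 by (simp add: has_bochner_integral_iff mult.commute)
    qed (auto simp: b0 b'0)
  qed auto
  \<comment> \<open>Adding and subtracting \<open>b t *\<^sub>R K\<close> completes the derivative of \<open>b t *\<^sub>R (C + t *\<^sub>R K)\<close>.\<close>
  also have "\<dots> = (LINT t | lborel. indicator {0..T} t *\<^sub>R (b' t *\<^sub>R (C + t *\<^sub>R K) + b t *\<^sub>R K)
      - (indicator {0..T} t * b t) *\<^sub>R (K - (hl - hr)))"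
    by (intro Bochner_Integration.integral_cong) (auto simp: algebra_simps)
  also have "\<dots> = (b T *\<^sub>R (C + T *\<^sub>R K) - b 0 *\<^sub>R (C + 0 *\<^sub>R K))
      - (LINT t | lborel. indicator {0..T} t * b t) *\<^sub>R (K - (hl - hr))"
  proof -
    have "has_bochner_integral lborel (\<lambda>t. indicator {0..T} t *\<^sub>R (b' t *\<^sub>R (C + t *\<^sub>R K) + b t *\<^sub>R K))
        (b T *\<^sub>R (C + T *\<^sub>R K) - b 0 *\<^sub>R (C + 0 *\<^sub>R K))"
    proof (rule has_bochner_integral_FTC_Icc)
      fix t
      have "(b has_real_derivative b' t) (at t within {0..T})"
        by (rule has_field_derivative_at_within[OF has_C1_derivD(1)[OF b]])
      then show "((\<lambda>t. b t *\<^sub>R (C + t *\<^sub>R K)) has_vector_derivative b' t *\<^sub>R (C + t *\<^sub>R K) + b t *\<^sub>R K)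
          (at t within {0..T})"
        by (auto intro!: derivative_eq_intros)
    qed (use T in \<open>auto intro!: continuous_intros has_C1_derivD[OF b]\<close>)
    moreover have "integrable lborel (\<lambda>t. indicator {0..T} t * b t)"
      using borel_integrable_compact[of "{0..T}" b] has_C1_derivD(2)[OF b] by simp
    ultimately show ?thesis by (simp add: has_bochner_integral_iff)
  qed
  finally show ?thesis using b0[of T] by (simp add: C_def K_def)
qed

section \<open>Limits of cutoff functions\<close>

lemma cutoff_tendsto_indicator:
  assumes e: "\<And>n. 0 < e n" "e \<longlonglongrightarrow> 0"
    and c: "\<And>n. c \<le> c' n" "c' \<longlonglongrightarrow> c" and d: "\<And>n. d' n \<le> d" "d' \<longlonglongrightarrow> d"
  shows "(\<lambda>n. cutoff (c' n) (d' n) (e n) x) \<longlonglongrightarrow> indicator {c<..<d} x"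
proof (cases "x \<in> {c<..<d}")
  case True
  have "(\<lambda>n. c' n + e n) \<longlonglongrightarrow> c + 0" "(\<lambda>n. d' n - e n) \<longlonglongrightarrow> d - 0"
    by (intro tendsto_intros c d e)+
  then have "\<forall>\<^sub>F n in sequentially. c' n + e n < x" "\<forall>\<^sub>F n in sequentially. x < d' n - e n"
    using True by (auto intro: order_tendstoD)
  then have "\<forall>\<^sub>F n in sequentially. cutoff (c' n) (d' n) (e n) x = indicator {c<..<d} x"
    by eventually_elim (use True e in \<open>auto intro!: cutoff_eq_1\<close>)
  then show ?thesis by (rule tendsto_eventually)
next
  case False
  have "cutoff (c' n) (d' n) (e n) x = 0" for n
    using False c(1)[of n] d(1)[of n] e(1)[of n] by (intro cutoff_eq_0) auto
  then show ?thesis using False by simp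
qed

lemma cutoff_le_indicator:
  assumes "0 < e" "c \<le> c'" "d' \<le> d"
  shows "cutoff c' d' e x \<le> indicator {c<..<d} x"
proof (cases "x \<in> {c'<..<d'}")
  case True
  then show ?thesis using assms cutoff_range by (auto simp: indicator_def)
next
  case False
  then show ?thesis using assms(1) by (simp add: cutoff_eq_0)
qed

lemma cutoff_borel_measurable: "0 < e \<Longrightarrow> cutoff c d e \<in> borel_measurable borel"
  by (metis cutoff_C1 has_C1_derivD(4))

section \<open>Conservation of the state variable\<close>

text \<open>
  For the solution itself the production vanishes.  A cutoff in time with \<open>b 0 = 1\<close> is used, so that the
  boundary term of the integration by parts cancels the term of the initial data in the weak form.
\<close>
lemma weak_riemann_excess:
  fixes f :: "real ^ 'm \<Rightarrow> real ^ 'm"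
  assumes sol: "riemann_solution f ul ur u"
    and u: "\<And>x t. 0 < t \<Longrightarrow> u x t = w (x / t)" and fan: "fan m ul ur w" and m: "0 < m"
  shows "excess ul ur w = f ul - f ur"
proof -
  define a where "a = cutoff (- (m + 1)) (m + 1) 1"
  define b where "b = cutoff (-1) 1 (1 / 2)"
  obtain a' where a: "has_C1_deriv a a'" unfolding a_def by (rule cutoff_C1[OF zero_less_one])
  obtain b' where b: "has_C1_deriv b b'" unfolding b_def by (rule cutoff_C1[of "1 / 2"]) simp
  have a0: "x \<notin> {- (m + 1)<..<m + 1} \<Longrightarrow> a x = 0" for x
    unfolding a_def by (rule cutoff_eq_0) auto
  have a1: "x \<in> {- m..m} \<Longrightarrow> a x = 1" for x
    unfolding a_def by (rule cutoff_eq_1) auto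
  have b0: "t \<notin> {-1<..<1} \<Longrightarrow> b t = 0" for t
    unfolding b_def by (rule cutoff_eq_0) auto
  have b1: "t \<in> {0..1 / 2} \<Longrightarrow> b t = 1" for t
    unfolding b_def by (rule cutoff_eq_1) auto
  have range: "0 \<le> a x \<and> a x \<le> 1" "0 \<le> b x \<and> b x \<le> 1" for x
    unfolding a_def b_def by (rule cutoff_range)+
  define B where "B = (LINT t | lborel. indicator {0..1} t * b t)"
  have weak: "weak_solution f u" and u0: "x < 0 \<Longrightarrow> u x 0 = ul" "0 < x \<Longrightarrow> u x 0 = ur" for x
    using sol by (auto simp: riemann_solution_def)
  have test: "test_function (\<lambda>(x, t). a x * b t)"
    "partial_x (\<lambda>(x, t). a x * b t) (x, t) = a' x * b t"
    "partial_t (\<lambda>(x, t). a x * b t) (x, t) = a x * b' t" for x t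
    using product_test_function[OF a b a0 b0] by blast+
  have "(LINT (x, t) : UNIV \<times> {0<..} | lborel.
            partial_t (\<lambda>(x, t). a x * b t) (x, t) *\<^sub>R u x t + partial_x (\<lambda>(x, t). a x * b t) (x, t) *\<^sub>R f (u x t))
        + (LINT x | lborel. (\<lambda>(x, t). a x * b t) (x, 0) *\<^sub>R u x 0) = 0"
    using weak test(1) unfolding weak_solution_def by blast
  moreover have "(LINT x | lborel. (\<lambda>(x, t). a x * b t) (x, 0) *\<^sub>R u x 0) = (LINT x | lborel. a x *\<^sub>R step ul ur x)"
  proof (rule integral_discrete_difference[where X = "{0}"])
    fix x :: real assume "x \<notin> {0}"
    then show "(\<lambda>(x, t). a x * b t) (x, 0) *\<^sub>R u x 0 = a x *\<^sub>R step ul ur x"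
      using b1[of 0] u0[of x] by (auto simp: step_def)
  qed auto
  moreover have "(LINT (x, t) : UNIV \<times> {0<..} | lborel. (a x * b' t) *\<^sub>R u x t + (a' x * b t) *\<^sub>R f (u x t))
       = - (b 0 *\<^sub>R (LINT x | lborel. a x *\<^sub>R step ul ur x)) - B *\<^sub>R (excess ul ur w - (f ul - f ur))"
    unfolding B_def
  proof (rule fan_product_test_integral[where k = "\<lambda>y. f (w y)" and R = m and R' = "m + 1" and m = m])
    show "locally_integrable u" "locally_integrable (\<lambda>x t. f (u x t))"
      using weak by (auto simp: weak_solution_def)
    show "fan m (f ul) (f ur) (\<lambda>y. f (w y))" using fan by (simp add: fan_def)
  qed (use u fan m a b range a0 a1 b0 in auto)
  ultimately have "B *\<^sub>R (excess ul ur w - (f ul - f ur)) = 0"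
    using b1[of 0] by (simp add: test(2,3))
  moreover have "0 < B"
  proof -
    have "(LINT t | lborel. indicator {0..1 / 2 :: real} t) \<le> B"
      unfolding B_def
    proof (rule integral_mono)
      show "integrable lborel (\<lambda>t. indicator {0..1} t * b t)"
        using borel_integrable_compact[of "{0..1}" b] has_C1_derivD(2)[OF b] by simp
      show "indicator {0..1 / 2} t \<le> indicator {0..1} t * b t" for t
        using b1[of t] range(2)[of t] by (auto simp: indicator_def)
    qed (rule integrable_real_indicator, simp, rule emeasure_bounded_finite, simp)
    then show ?thesis by simp
  qed
  ultimately show ?thesis by simp
qed

section \<open>Entropy production\<close>

text \<open>
  Cutoff products recover the measure of an open rectangle.  The time interval \<open>(c' n, d' n)\<close> may
  approach \<open>(c, d)\<close> from inside; this keeps the supports away from \<open>t = 0\<close>.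
\<close>
lemma cutoff_product_integral_tendsto:
  assumes sets: "sets Q = sets borel" and fin: "\<And>K. compact K \<Longrightarrow> emeasure Q K < \<infinity>"
    and e: "\<And>n. 0 < e n" "e \<longlonglongrightarrow> 0"
    and c: "\<And>n. c \<le> c' n" "c' \<longlonglongrightarrow> c" and d: "\<And>n. d' n \<le> d" "d' \<longlonglongrightarrow> d"
  shows "(\<lambda>n. LINT (x, t) | Q. cutoff (-M) M (e n) x * cutoff (c' n) (d' n) (e n) t)
           \<longlonglongrightarrow> measure Q ({-M<..<M} \<times> {c<..<d})"
proof -
  let ?A = "{-M<..<M} \<times> {c<..<d}"
  have A: "?A \<in> sets Q" unfolding sets by (intro borel_open open_Times) auto
  have "emeasure Q ?A \<le> emeasure Q ({-M..M} \<times> {c..d})"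
    by (rule emeasure_mono) (auto simp: sets intro!: borel_closed closed_Times)
  also have "\<dots> < \<infinity>" by (intro fin compact_Times) auto
  finally have finA: "emeasure Q ?A < \<infinity>" .
  have [measurable_cong]: "sets Q = sets (borel \<Otimes>\<^sub>M borel)" unfolding sets borel_prod ..
  note [measurable] = cutoff_borel_measurable[OF e(1)]
  have "(\<lambda>n. LINT (x, t) | Q. cutoff (-M) M (e n) x * cutoff (c' n) (d' n) (e n) t)
      \<longlonglongrightarrow> (LINT p | Q. indicator ?A p)"
  proof (rule integral_dominated_convergence[where w = "indicator ?A"])
    show "(\<lambda>(x, t). cutoff (-M) M (e n) x * cutoff (c' n) (d' n) (e n) t) \<in> borel_measurable Q" for n
      by measurable
    show "AE p in Q. (\<lambda>n. (\<lambda>(x, t). cutoff (-M) M (e n) x * cutoff (c' n) (d' n) (e n) t) p)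
        \<longlonglongrightarrow> indicator ?A p"
    proof (rule AE_I2)
      fix p :: "real \<times> real"
      have "(\<lambda>n. cutoff (-M) M (e n) (fst p) * cutoff (c' n) (d' n) (e n) (snd p))
          \<longlonglongrightarrow> indicator {-M<..<M} (fst p) * indicator {c<..<d} (snd p)"
        by (intro tendsto_mult cutoff_tendsto_indicator e c d) auto
      then show "(\<lambda>n. (\<lambda>(x, t). cutoff (-M) M (e n) x * cutoff (c' n) (d' n) (e n) t) p)
          \<longlonglongrightarrow> indicator ?A p"
        by (simp add: case_prod_beta indicator_times)
    qed
    show "AE p in Q. norm ((\<lambda>(x, t). cutoff (-M) M (e n) x * cutoff (c' n) (d' n) (e n) t) p) \<le> indicator ?A p" for n
    proof (rule AE_I2)
      fix p :: "real \<times> real"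
      have "cutoff (-M) M (e n) (fst p) * cutoff (c' n) (d' n) (e n) (snd p)
          \<le> indicator {-M<..<M} (fst p) * indicator {c<..<d} (snd p)"
        using cutoff_range by (intro mult_mono cutoff_le_indicator e c d) auto
      then show "norm ((\<lambda>(x, t). cutoff (-M) M (e n) x * cutoff (c' n) (d' n) (e n) t) p) \<le> indicator ?A p"
        using cutoff_range by (simp add: case_prod_beta indicator_times)
    qed
  qed (use A finA in auto)
  then show ?thesis using A sets.sets_into_space[OF A] by (simp add: Int_absorb2)
qed

text \<open>
  Tested with cutoff products, the entropy production equals the production rate of the fan times the
  integral of the time cutoff, and both sides converge as the cutoffs tend to the indicator of the
  rectangle.  Two constraints fix the choice of the cutoffs.  The time cutoff starts at \<open>t0 + e\<close>, since
  for \<open>t0 = 0\<close> its support must remain in \<open>t > 0\<close>.  It ends at \<open>T = t1 - e / m\<close>, when the fan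
  still lies in the plateau \<open>[-(M - e), M - e]\<close>; this covers the case \<open>t1 * m = M\<close>, in which the fan reaches
  the ends of the interval at the final time.
\<close>
lemma entropy_dissipation_fan:
  assumes epm: "entropy_production_measure U F u P N"
    and u: "\<And>x t. 0 < t \<Longrightarrow> u x t = w (x / t)" and fan: "fan m ul ur w" and m: "0 < m"
    and t: "0 \<le> t0" "t0 < t1" "t1 * m \<le> M"
  shows "entropy_dissipation P N {-M<..<M} t0 t1
       = (t1 - t0) * (excess (U ul) (U ur) (\<lambda>y. U (w y)) - (F ul - F ur))"
proof -
  define \<sigma> where "\<sigma> = excess (U ul) (U ur) (\<lambda>y. U (w y)) - (F ul - F ur)"
  \<comment> \<open>The factor \<open>t1 * m / 2\<close> keeps \<open>T n\<close> positive for every \<open>n\<close>.\<close>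
  define e where "e n = t1 * m / 2 * inverse (real (Suc n))" for n
  define T where "T n = t1 - e n / m" for n
  have t1: "0 < t1" using t by simp
  have e: "0 < e n" for n using t1 m by (simp add: e_def)
  have e_lim: "e \<longlonglongrightarrow> 0"
    unfolding e_def by (intro tendsto_mult_right_zero LIMSEQ_inverse_real_of_nat)
  have "e n \<le> t1 * m / 2 * 1" for n
    unfolding e_def using t1 m by (intro mult_left_mono) (auto simp: inverse_le_1_iff)
  then have "e n \<le> t1 * m / 2" for n by simp
  moreover have "t1 * m / 2 < t1 * m" using mult_pos_pos[OF t1 m] by linarith
  ultimately have e_le: "e n < t1 * m" for n by (rule le_less_trans)
  have T: "0 < T n" "T n \<le> t1" "T n * m = t1 * m - e n" for n
    using e[of n] e_le[of n] m by (auto simp: T_def field_simps)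
  have "T \<longlonglongrightarrow> t1 - 0 / m"
    unfolding T_def by (intro tendsto_intros e_lim) (use m in auto)
  then have T_lim: "T \<longlonglongrightarrow> t1" by simp
  have "(\<lambda>n. t0 + e n) \<longlonglongrightarrow> t0 + 0" by (intro tendsto_intros e_lim)
  then have c_lim: "(\<lambda>n. t0 + e n) \<longlonglongrightarrow> t0" by simp
  define a where "a n = cutoff (-M) M (e n)" for n
  define b where "b n = cutoff (t0 + e n) (T n) (e n)" for n
  have tested: "(LINT (x, t) | P. a n x * b n t) - (LINT (x, t) | N. a n x * b n t)
      = (LINT t | lborel. b n t) * \<sigma>" for n
  proof -
    obtain a' where a: "has_C1_deriv (a n) a'" unfolding a_def by (rule cutoff_C1[OF e])
    obtain b' where b: "has_C1_deriv (b n) b'" unfolding b_def by (rule cutoff_C1[OF e])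
    have a0: "x \<notin> {-M<..<M} \<Longrightarrow> a n x = 0" for x
      unfolding a_def by (rule cutoff_eq_0[OF e])
    have a1: "x \<in> {- (M - e n)..M - e n} \<Longrightarrow> a n x = 1" for x
      unfolding a_def by (rule cutoff_eq_1[OF e]) auto
    have b0: "s \<notin> {t0 + e n<..<T n} \<Longrightarrow> b n s = 0" for s
      unfolding b_def by (rule cutoff_eq_0[OF e])
    have range: "0 \<le> a n x \<and> a n x \<le> 1" "0 \<le> b n x \<and> b n x \<le> 1" for x
      unfolding a_def b_def by (rule cutoff_range)+
    let ?\<phi> = "\<lambda>(x, t). a n x * b n t"
    have test: "test_function ?\<phi>" "partial_x ?\<phi> (x, t) = a' x * b n t" "partial_t ?\<phi> (x, t) = a n x * b' t"
      "closure {p. ?\<phi> p \<noteq> 0} \<subseteq> UNIV \<times> {t0 + e n..T n}" for x t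
      using product_test_function[OF a b a0 b0] by blast+
    have "closure {p. ?\<phi> p \<noteq> 0} \<subseteq> UNIV \<times> {0<..}"
      using test(4) e[of n] t(1) by fastforce
    then have "(LINT p | P. ?\<phi> p) - (LINT p | N. ?\<phi> p) =
        - (LINT (x, t) : UNIV \<times> {0<..} | lborel.
             U (u x t) * partial_t ?\<phi> (x, t) + F (u x t) * partial_x ?\<phi> (x, t))"
      using epm test(1) unfolding entropy_production_measure_def by blast
    also have "\<dots> = - (LINT (x, t) : UNIV \<times> {0<..} | lborel.
             (a n x * b' t) *\<^sub>R U (u x t) + (a' x * b n t) *\<^sub>R F (u x t))"
      by (simp add: test(2,3) mult.commute)
    also have "(LINT (x, t) : UNIV \<times> {0<..} | lborel.
             (a n x * b' t) *\<^sub>R U (u x t) + (a' x * b n t) *\<^sub>R F (u x t))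
        = - (b n 0 *\<^sub>R (LINT x | lborel. a n x *\<^sub>R step (U ul) (U ur) x))
          - (LINT s | lborel. indicator {0..T n} s * b n s) *\<^sub>R
              (excess (U ul) (U ur) (\<lambda>y. U (w y)) - (F ul - F ur))"
    proof (rule fan_product_test_integral[where k = "\<lambda>y. F (w y)" and R = "M - e n" and R' = M and m = m])
      show "locally_integrable (\<lambda>x t. U (u x t))" "locally_integrable (\<lambda>x t. F (u x t))"
        using epm by (auto simp: entropy_production_measure_def)
      show "fan m (U ul) (U ur) (\<lambda>y. U (w y))" "fan m (F ul) (F ur) (\<lambda>y. F (w y))"
        using fan by (simp_all add: fan_def)
      show "T n * m \<le> M - e n" using T(3)[of n] t(3) by simp
    qed (use u m a b range a0 a1 b0 T in auto)
    also have "b n 0 = 0" using b0[of 0] t(1) e[of n] by simp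
    also have "(\<lambda>s. indicator {0..T n} s * b n s) = b n"
    proof
      fix s
      show "indicator {0..T n} s * b n s = b n s"
        using b0[of s] t(1) e[of n] by (cases "s \<in> {t0 + e n<..<T n}") auto
    qed
    finally show ?thesis by (simp add: \<sigma>_def)
  qed
  have "(\<lambda>n. (LINT (x, t) | P. a n x * b n t) - (LINT (x, t) | N. a n x * b n t))
      \<longlonglongrightarrow> entropy_dissipation P N {-M<..<M} t0 t1"
    unfolding a_def b_def entropy_dissipation_def
    using epm by (intro tendsto_diff cutoff_product_integral_tendsto)
      (auto simp: entropy_production_measure_def less_imp_le e T e_lim T_lim c_lim)
  moreover have "(\<lambda>n. (LINT s | lborel. b n s) * \<sigma>) \<longlonglongrightarrow> (LINT s | lborel. indicator {t0<..<t1} s) * \<sigma>"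
  proof (intro tendsto_mult_right integral_dominated_convergence[where w = "indicator {t0<..<t1}"])
    show "b n \<in> borel_measurable lborel" for n
      unfolding b_def using cutoff_borel_measurable[OF e] by simp
    show "AE s in lborel. (\<lambda>n. b n s) \<longlonglongrightarrow> indicator {t0<..<t1} s"
      unfolding b_def by (intro AE_I2 cutoff_tendsto_indicator e e_lim T T_lim c_lim) (simp add: less_imp_le e)
    show "AE s in lborel. norm (b n s) \<le> indicator {t0<..<t1} s" for n
      unfolding b_def using cutoff_range
      by (intro AE_I2) (simp add: cutoff_le_indicator e T less_imp_le)
  qed (use t in auto)
  ultimately show ?thesis
    using t unfolding tested \<sigma>_def by (auto dest: LIMSEQ_unique)
qed

text \<open>
  The strict inequality \<open>t * m < M\<close> leaves room for later times \<open>\<tau>\<close>, so the linear formula holds in a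
  full neighbourhood of \<open>t\<close> in \<open>{t0..}\<close>.  For \<open>\<tau> = t0\<close> the rectangle is empty.
\<close>
lemma entropy_dissipation_rate_fan:
  assumes epm: "entropy_production_measure U F u P N"
    and u: "\<And>x t. 0 < t \<Longrightarrow> u x t = w (x / t)" and fan: "fan m ul ur w" and m: "0 < m"
    and t: "0 \<le> t" "t * m < M"
  shows "has_entropy_dissipation_rate P N {-M<..<M} t
       (excess (U ul) (U ur) (\<lambda>y. U (w y)) - (F ul - F ur))"
  unfolding has_entropy_dissipation_rate_def
proof (intro allI impI)
  let ?\<sigma> = "excess (U ul) (U ur) (\<lambda>y. U (w y)) - (F ul - F ur)"
  fix t0 assume t0: "0 \<le> t0 \<and> t0 \<le> t"
  have "((\<lambda>\<tau>. (\<tau> - t0) * ?\<sigma>) has_real_derivative ?\<sigma>) (at t within {t0..})"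
    by (auto intro!: derivative_eq_intros)
  then show "((\<lambda>\<tau>. entropy_dissipation P N {-M<..<M} t0 \<tau>) has_real_derivative ?\<sigma>) (at t within {t0..})"
  proof (rule has_field_derivative_transform_within)
    show "0 < M / m - t" using t m by (simp add: field_simps)
    show "t \<in> {t0..}" using t0 by simp
    fix \<tau> assume \<tau>: "\<tau> \<in> {t0..}" "dist \<tau> t < M / m - t"
    show "(\<tau> - t0) * ?\<sigma> = entropy_dissipation P N {-M<..<M} t0 \<tau>"
    proof (cases "\<tau> = t0")
      case False
      have "\<tau> < M / m" using \<tau>(2) by (auto simp: dist_real_def)
      then have "\<tau> * m \<le> M" using m by (simp add: field_simps)
      then show ?thesis
        using entropy_dissipation_fan[OF epm u fan m, of t0 \<tau> M] t0 \<tau> False by simp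
    qed (simp add: entropy_dissipation_def)
  qed
qed

section \<open>The inequality of Jensen\<close>

text \<open>
  The one-dimensional tangent inequality on the line through \<open>z\<close> and \<open>y\<close>.
\<close>
lemma convex_above_tangent_plane:
  fixes U :: "'a::real_inner \<Rightarrow> real"
  assumes conv: "convex_on UNIV U" and g: "GDERIV U z :> g"
  shows "U z + (y - z) \<bullet> g \<le> U y"
proof -
  let ?l = "\<lambda>s. z + s *\<^sub>R (y - z)"
  have "convex_on UNIV (\<lambda>s. U (?l s))"
  proof (rule convex_onI)
    fix s p q :: real assume "0 < s" "s < 1"
    moreover have "?l ((1 - s) *\<^sub>R p + s *\<^sub>R q) = (1 - s) *\<^sub>R ?l p + s *\<^sub>R ?l q"
      by (simp add: algebra_simps)
    ultimately show "U (?l ((1 - s) *\<^sub>R p + s *\<^sub>R q)) \<le> (1 - s) * U (?l p) + s * U (?l q)"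
      using convex_onD[OF conv, of s "?l p" "?l q"] by simp
  qed simp
  moreover have "((\<lambda>s. U (?l s)) has_real_derivative (y - z) \<bullet> g) (at 0)"
  proof -
    have "(?l has_derivative (\<lambda>s. s *\<^sub>R (y - z))) (at 0)" by (auto intro!: derivative_eq_intros)
    moreover have "(U has_derivative (\<lambda>h. h \<bullet> g)) (at (?l 0))" using g by (simp add: gderiv_def)
    ultimately have "((\<lambda>s. U (?l s)) has_derivative (\<lambda>s. (s *\<^sub>R (y - z)) \<bullet> g)) (at 0)"
      by (rule has_derivative_compose)
    then show ?thesis by (simp add: has_field_derivative_def mult_commute_abs)
  qed
  ultimately have "U (?l 1) - U (?l 0) \<ge> (y - z) \<bullet> g * (1 - 0)"
    by (intro convex_on_imp_above_tangent[of UNIV]) auto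
  then show ?thesis by simp
qed

text \<open>
  Jensen's inequality for vector-valued \<open>w\<close>: the tangent plane at the mean \<open>z\<close> lies below \<open>U\<close> and has
  the integral \<open>(q - p) * U z\<close> along \<open>w\<close>.
\<close>
lemma jensen_interval:
  fixes w :: "real \<Rightarrow> 'a::euclidean_space" and U :: "'a \<Rightarrow> real"
  assumes conv: "convex_on UNIV U" and g: "GDERIV U z :> g" and "p \<le> q"
    and mean: "has_bochner_integral lborel (\<lambda>y. indicator {p..q} y *\<^sub>R w y) ((q - p) *\<^sub>R z)"
    and int: "has_bochner_integral lborel (\<lambda>y. indicator {p..q} y *\<^sub>R U (w y)) I"
  shows "(q - p) * U z \<le> I"
proof -
  have "has_bochner_integral lborel
      (\<lambda>y. indicator {p..q} y *\<^sub>R (U z - z \<bullet> g) + (indicator {p..q} y *\<^sub>R w y) \<bullet> g)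
      (measure lborel {p..q} *\<^sub>R (U z - z \<bullet> g) + ((q - p) *\<^sub>R z) \<bullet> g)"
    by (intro has_bochner_integral_add has_bochner_integral_const_on has_bochner_integral_inner_left mean)
      (simp_all add: \<open>p \<le> q\<close>)
  moreover have "indicator {p..q} y *\<^sub>R (U z - z \<bullet> g) + (indicator {p..q} y *\<^sub>R w y) \<bullet> g
      \<le> indicator {p..q} y *\<^sub>R U (w y)" for y
    using convex_above_tangent_plane[OF conv g, of "w y"]
    by (auto simp: indicator_def inner_diff_left)
  ultimately have "measure lborel {p..q} *\<^sub>R (U z - z \<bullet> g) + ((q - p) *\<^sub>R z) \<bullet> g \<le> I"
    using int unfolding has_bochner_integral_iff by (metis (no_types, lifting) integral_mono)
  then show ?thesis using \<open>p \<le> q\<close> by (simp add: algebra_simps)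
qed

section \<open>The entropy bounds\<close>

theorem lemma2:
  fixes f :: "real ^ 'm \<Rightarrow> real ^ 'm"
    and U F :: "real ^ 'm \<Rightarrow> real"
    and u :: "real \<Rightarrow> real \<Rightarrow> real ^ 'm"
    and ul ur ulr :: "real ^ 'm"
    and al ar M :: real
  assumes "hyperbolic f"
    and "entropy_pair f U F"
    and "al < ar"
    and "M \<ge> max \<bar>al\<bar> \<bar>ar\<bar>"
    and "riemann_solution f ul ur u"
    and "self_similar u"
    and "signal_speed_bounds al ar ul ur u"
    and "\<And>t. t \<ge> 0 \<Longrightarrow> set_integrable lborel {-M<..<M} (\<lambda>x. U (u x t))"
    and "ulr = (1 / (ar - al)) *\<^sub>R (ar *\<^sub>R ur - al *\<^sub>R ul + f ul - f ur)"
  shows "(\<forall>t\<ge>0. t * max \<bar>al\<bar> \<bar>ar\<bar> \<le> M \<longrightarrow>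
            total_entropy U u {-M<..<M} t - total_entropy U u {-M<..<M} 0
              \<ge> t * ((ar - al) * U ulr + al * U ul - ar * U ur))
       \<and> (\<exists>D. ((\<lambda>t. total_entropy U u {-M<..<M} t) has_real_derivative D) (at 0 within {0..})
              \<and> D \<ge> (ar - al) * U ulr + al * U ul - ar * U ur)
       \<and> (\<forall>P N. entropy_production_measure U F u P N \<longrightarrow>
            (\<forall>t\<ge>0. t * max \<bar>al\<bar> \<bar>ar\<bar> \<le> M \<longrightarrow>
               entropy_dissipation P N {-M<..<M} 0 t
                 \<ge> t * ((ar - al) * U ulr + al * U ul - ar * U ur + F ur - F ul))
          \<and> (\<forall>t\<ge>0. t * max \<bar>al\<bar> \<bar>ar\<bar> < M \<longrightarrow>
               (\<exists>\<sigma>. has_entropy_dissipation_rate P N {-M<..<M} t \<sigma>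
                  \<and> \<sigma> \<ge> (ar - al) * U ulr + al * U ul - ar * U ur + F ur - F ul)))"
proof -
  define m where "m = max \<bar>al\<bar> \<bar>ar\<bar>"
  define w where "w y = u y 1" for y
  define K where "K = excess (U ul) (U ur) (\<lambda>y. U (w y))"
  define bound where "bound = (ar - al) * U ulr + al * U ul - ar * U ur"
  have m: "0 < m" "m \<le> M" using assms(3,4) by (auto simp: m_def)
  have u: "u x t = w (x / t)" if "0 < t" for x t
    using assms(6)[unfolded self_similar_def, rule_format, of "1 / t" t x] that by (simp add: w_def)
  have left: "y < al \<Longrightarrow> w y = ul" and right: "ar < y \<Longrightarrow> w y = ur" for y
    using assms(7)[unfolded signal_speed_bounds_def, rule_format, of 1 y] by (auto simp: w_def)
  have "- m \<le> al" "ar \<le> m" by (auto simp: m_def)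
  then have fan: "fan m ul ur w" using left right by (simp add: fan_def)
  then have fan_U: "fan m (U ul) (U ur) (\<lambda>y. U (w y))" by (simp add: fan_def)
  have u0: "x < 0 \<Longrightarrow> u x 0 = ul" "0 < x \<Longrightarrow> u x 0 = ur" for x
    using assms(5) by (auto simp: riemann_solution_def)

  have int_w: "integrable lborel (\<lambda>y. w y - step ul ur y)"
  proof (rule fan_integrable_excess[OF fan])
    show "integrable lborel (\<lambda>x. indicator {-m<..<m} x *\<^sub>R w x)"
    proof (rule locally_integrable_profile[where v = u])
      show "locally_integrable u"
        using assms(5) by (auto simp: riemann_solution_def weak_solution_def)
    qed (use u m in auto)
  qed (use m in auto)
  have int_U: "integrable lborel (\<lambda>y. U (w y) - step (U ul) (U ur) y)"
    using assms(8)[of 1] m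
    by (intro fan_integrable_excess[OF fan_U, of M]) (auto simp: set_integrable_def w_def)

  \<comment> \<open>The conservation law determines the mean of the profile over \<open>[al, ar]\<close>: it is \<open>ulr\<close>.\<close>
  have excess_u: "excess ul ur w = f ul - f ur"
    by (rule weak_riemann_excess[OF assms(5) u fan m(1)])
  have "bound \<le> K"
  proof -
    obtain g where g: "GDERIV U ulr :> g"
      using assms(2) unfolding entropy_pair_def by blast
    have "(ar - al) *\<^sub>R ulr = excess ul ur w - al *\<^sub>R ul + ar *\<^sub>R ur"
      using assms(3) unfolding excess_u assms(9) by simp
    then have "has_bochner_integral lborel (\<lambda>y. indicator {al..ar} y *\<^sub>R w y) ((ar - al) *\<^sub>R ulr)"
      using integral_between_signals[OF int_w _ left right] assms(3) by simp
    moreover have "has_bochner_integral lborel (\<lambda>y. indicator {al..ar} y *\<^sub>R U (w y))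
        (K - al *\<^sub>R U ul + ar *\<^sub>R U ur)"
      unfolding K_def using assms(3) by (intro integral_between_signals[OF int_U]) (auto simp: left right)
    ultimately have "(ar - al) * U ulr \<le> K - al *\<^sub>R U ul + ar *\<^sub>R U ur"
      using assms(2,3) by (intro jensen_interval[OF _ g]) (auto simp: entropy_pair_def)
    then show ?thesis by (simp add: bound_def)
  qed

  have E: "total_entropy U u {-M<..<M} t = t * K + M * (U ul + U ur)" if t: "0 \<le> t" "t * m \<le> M" for t
  proof (cases "t = 0")
    case False
    then have "0 < t" using t by simp
    then show ?thesis
      using fan_total[OF fan_U _ int_U _ t(2)] m
      by (simp add: total_entropy_def set_lebesgue_integral_def u has_bochner_integral_iff K_def)
  next
    case True
    have "(LINT x | lborel. indicator {-M<..<M} x *\<^sub>R U (u x 0))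
        = (LINT x | lborel. indicator {-M<..<M} x *\<^sub>R step (U ul) (U ur) x)"
    proof (rule integral_discrete_difference[where X = "{0}"])
      fix x :: real assume "x \<notin> {0}"
      then show "indicator {-M<..<M} x *\<^sub>R U (u x 0) = indicator {-M<..<M} x *\<^sub>R step (U ul) (U ur) x"
        using u0[of x] by (auto simp: step_def)
    qed auto
    then show ?thesis
      using True step_integral[of M "U ul" "U ur"] m
      by (simp add: total_entropy_def set_lebesgue_integral_def has_bochner_integral_iff)
  qed

  have "total_entropy U u {-M<..<M} t - total_entropy U u {-M<..<M} 0 \<ge> t * bound"
    if "0 \<le> t" "t * m \<le> M" for t
    using E[OF that] E[of 0] m mult_left_mono[OF \<open>bound \<le> K\<close> that(1)] by simp
  moreover have "((\<lambda>t. total_entropy U u {-M<..<M} t) has_real_derivative K) (at 0 within {0..})"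
  proof -
    have "((\<lambda>t. t * K + M * (U ul + U ur)) has_real_derivative K) (at 0 within {0..})"
      by (auto intro!: derivative_eq_intros)
    then show ?thesis
    proof (rule has_field_derivative_transform_within)
      show "0 < M / m" using m by simp
      fix t :: real assume "t \<in> {0..}" "dist t 0 < M / m"
      then show "t * K + M * (U ul + U ur) = total_entropy U u {-M<..<M} t"
        using E[of t] m by (simp add: field_simps)
    qed simp
  qed
  moreover have "entropy_dissipation P N {-M<..<M} 0 t \<ge> t * (bound + F ur - F ul)"
    if "entropy_production_measure U F u P N" "0 \<le> t" "t * m \<le> M" for P N t
  proof (cases "t = 0")
    case False
    have "entropy_dissipation P N {-M<..<M} 0 t = (t - 0) * (K - (F ul - F ur))"
      unfolding K_def using that False
      by (intro entropy_dissipation_fan[OF that(1) u fan m(1)]) auto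
    moreover have "t * (bound + F ur - F ul) \<le> t * (K - (F ul - F ur))"
      using that(2) \<open>bound \<le> K\<close> by (intro mult_left_mono) auto
    ultimately show ?thesis by simp
  qed (simp add: entropy_dissipation_def)
  moreover have "has_entropy_dissipation_rate P N {-M<..<M} t (K - (F ul - F ur))"
    if "entropy_production_measure U F u P N" "0 \<le> t" "t * m < M" for P N t
    unfolding K_def by (rule entropy_dissipation_rate_fan[OF that(1) u fan m(1) that(2,3)])
  moreover have "K - (F ul - F ur) \<ge> bound + F ur - F ul" using \<open>bound \<le> K\<close> by simp
  ultimately show ?thesis
    using \<open>bound \<le> K\<close> unfolding m_def[symmetric] bound_def[symmetric] by blast
qed

end
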